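(* Let $G$ be a first-order structure expanding a discrete amenable group, and let $A\subseteq G$ be a definable set which is stable. If the upper Banach density of $A$ is positive, then there are infinite sets $B,C\subseteq G$ such that $B\cdot C=\{b\cdot c:b\in B,c\in C\}\subseteq A$.
   Context: A group is amenable if it admits a finitely additive left-invariant probability measure defined on all of its subsets. The upper Banach density $\mathrm{BD}(A)$ of a subset $A$ of an amenable group $G$ is defined via Følner sequences/nets (for countable $G$: $\mathrm{BD}(A)=\sup\{\limsup_n |A\cap F_n|/|F_n|\}$, the supremum over all left Følner sequences $(F_n)$); equivalently, $\mathrm{BD}(A)$ is the supremum of $\mu(A)$ over finitely additive left-invariant probability measures $\mu$ on all subsets of $G$. A definable set $A\subseteq G$ is called stable if the formula $x\cdot y\in A$ does not have the order property, i.e. there are no sequences $(b_i)_{i<\omega}$, $(c_j)_{j<\omega}$ in $G$ such that $b_i\cdot c_j\in A$ holds if and only if $i\leq j$.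
   Formalization: The group G is additionally assumed to be infinite; for a finite group G with A = G the statement as written fails, since A is stable with density 1 but G has no infinite subsets. *)

theory Defs
  imports "HOL-Analysis.Analysis" "HOL-Algebra.Coset"
begin

section \<open>First-order structures and definable sets\<close>

text \<open>
  A structure carries its signature as two sets of (symbol, arity) pairs, so that languages
  without function symbols or without relation symbols are covered as well.
\<close>

record ('a, 'f, 'r) fo_structure =
  universe :: "'a set"
  fun_syms :: "('f \<times> nat) set"
  rel_syms :: "('r \<times> nat) set"
  fun_interp :: "'f \<Rightarrow> 'a list \<Rightarrow> 'a"
  rel_interp :: "'r \<Rightarrow> 'a list \<Rightarrow> bool"

definition is_structure :: "('a, 'f, 'r) fo_structure \<Rightarrow> bool" where
  "is_structure M \<longleftrightarrow> universe M \<noteq> {} \<and>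
     (\<forall>(f, n) \<in> fun_syms M. \<forall>xs. length xs = n \<and> set xs \<subseteq> universe M \<longrightarrow>
        fun_interp M f xs \<in> universe M)"

datatype 'f fo_term = Var nat | App 'f "'f fo_term list"

datatype ('f, 'r) fo_formula =
    Eq "'f fo_term" "'f fo_term"
  | Rel 'r "'f fo_term list"
  | Neg "('f, 'r) fo_formula"
  | Conj "('f, 'r) fo_formula" "('f, 'r) fo_formula"
  | Exists nat "('f, 'r) fo_formula"

fun wf_term :: "('a, 'f, 'r) fo_structure \<Rightarrow> 'f fo_term \<Rightarrow> bool" where
  "wf_term M (Var v) \<longleftrightarrow> True"
| "wf_term M (App f ts) \<longleftrightarrow> (f, length ts) \<in> fun_syms M \<and> (\<forall>t \<in> set ts. wf_term M t)"

primrec wf_formula :: "('a, 'f, 'r) fo_structure \<Rightarrow> ('f, 'r) fo_formula \<Rightarrow> bool" where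
  "wf_formula M (Eq s t) \<longleftrightarrow> wf_term M s \<and> wf_term M t"
| "wf_formula M (Rel R ts) \<longleftrightarrow> (R, length ts) \<in> rel_syms M \<and> (\<forall>t \<in> set ts. wf_term M t)"
| "wf_formula M (Neg \<phi>) \<longleftrightarrow> wf_formula M \<phi>"
| "wf_formula M (Conj \<phi> \<psi>) \<longleftrightarrow> wf_formula M \<phi> \<and> wf_formula M \<psi>"
| "wf_formula M (Exists v \<phi>) \<longleftrightarrow> wf_formula M \<phi>"

primrec eval_term :: "('a, 'f, 'r) fo_structure \<Rightarrow> (nat \<Rightarrow> 'a) \<Rightarrow> 'f fo_term \<Rightarrow> 'a" where
  "eval_term M \<sigma> (Var v) = \<sigma> v"
| "eval_term M \<sigma> (App f ts) = fun_interp M f (map (eval_term M \<sigma>) ts)"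

primrec sat :: "('a, 'f, 'r) fo_structure \<Rightarrow> (nat \<Rightarrow> 'a) \<Rightarrow> ('f, 'r) fo_formula \<Rightarrow> bool" where
  "sat M \<sigma> (Eq s t) \<longleftrightarrow> eval_term M \<sigma> s = eval_term M \<sigma> t"
| "sat M \<sigma> (Rel R ts) \<longleftrightarrow> rel_interp M R (map (eval_term M \<sigma>) ts)"
| "sat M \<sigma> (Neg \<phi>) \<longleftrightarrow> \<not> sat M \<sigma> \<phi>"
| "sat M \<sigma> (Conj \<phi> \<psi>) \<longleftrightarrow> sat M \<sigma> \<phi> \<and> sat M \<sigma> \<psi>"
| "sat M \<sigma> (Exists v \<phi>) \<longleftrightarrow> (\<exists>a \<in> universe M. sat M (\<sigma>(v := a)) \<phi>)"

text \<open>
  Definable means definable with parameters, as usual. The variable 0 ranges over the set being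
  defined; the values of the assignment at the other free variables are the parameters.
\<close>

definition definable :: "('a, 'f, 'r) fo_structure \<Rightarrow> 'a set \<Rightarrow> bool" where
  "definable M A \<longleftrightarrow> (\<exists>\<phi> \<sigma>. wf_formula M \<phi> \<and> range \<sigma> \<subseteq> universe M \<and>
     A = {x \<in> universe M. sat M (\<sigma>(0 := x)) \<phi>})"

text \<open>
  Only multiplication is required to be named by a symbol: the identity and the inverse are
  definable from it, so naming them too would not change the definable sets.
\<close>

definition expands_group :: "('a, 'f, 'r) fo_structure \<Rightarrow> ('a, 'b) monoid_scheme \<Rightarrow> bool" where
  "expands_group M G \<longleftrightarrow> is_structure M \<and> group G \<and> universe M = carrier G \<and>
     (\<exists>m. (m, 2) \<in> fun_syms M \<and>
        (\<forall>x \<in> carrier G. \<forall>y \<in> carrier G. fun_interp M m [x, y] = x \<otimes>\<^bsub>G\<^esub> y))"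

definition stable_set :: "('a, 'b) monoid_scheme \<Rightarrow> 'a set \<Rightarrow> bool" where
  "stable_set G A \<longleftrightarrow>
     \<not> (\<exists>b c :: nat \<Rightarrow> 'a. range b \<subseteq> carrier G \<and> range c \<subseteq> carrier G \<and>
          (\<forall>i j. b i \<otimes>\<^bsub>G\<^esub> c j \<in> A \<longleftrightarrow> i \<le> j))"


section \<open>Amenability and upper Banach density\<close>

definition invariant_mean :: "('a, 'b) monoid_scheme \<Rightarrow> ('a set \<Rightarrow> real) \<Rightarrow> bool" where
  "invariant_mean G \<mu> \<longleftrightarrow>
     (\<forall>X \<subseteq> carrier G. 0 \<le> \<mu> X) \<and>
     \<mu> (carrier G) = 1 \<and>
     (\<forall>X \<subseteq> carrier G. \<forall>Y \<subseteq> carrier G. X \<inter> Y = {} \<longrightarrow> \<mu> (X \<union> Y) = \<mu> X + \<mu> Y) \<and>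
     (\<forall>g \<in> carrier G. \<forall>X \<subseteq> carrier G. \<mu> (g <#\<^bsub>G\<^esub> X) = \<mu> X)"

definition amenable_group :: "('a, 'b) monoid_scheme \<Rightarrow> bool" where
  "amenable_group G \<longleftrightarrow> group G \<and> (\<exists>\<mu>. invariant_mean G \<mu>)"

text \<open>
  A net indexed by a directed set is represented by its index type together with the filter
  generated by the tails; a sequence is the case of the filter \<open>sequentially\<close>.
\<close>

definition foelner_net :: "('a, 'b) monoid_scheme \<Rightarrow> 'i filter \<Rightarrow> ('i \<Rightarrow> 'a set) \<Rightarrow> bool" where
  "foelner_net G \<Phi> F \<longleftrightarrow> \<Phi> \<noteq> bot \<and>
     (\<forall>\<^sub>F i in \<Phi>. finite (F i) \<and> F i \<noteq> {} \<and> F i \<subseteq> carrier G) \<and>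
     (\<forall>g \<in> carrier G.
        ((\<lambda>i. real (card (sym_diff (g <#\<^bsub>G\<^esub> F i) (F i))) / real (card (F i))) \<longlongrightarrow> 0) \<Phi>)"

definition upper_density_along :: "'i filter \<Rightarrow> ('i \<Rightarrow> 'a set) \<Rightarrow> 'a set \<Rightarrow> ereal" where
  "upper_density_along \<Phi> F A = Limsup \<Phi> (\<lambda>i. ereal (real (card (A \<inter> F i)) / real (card (F i))))"

text \<open>
  The supremum over all left Foelner nets. One cannot quantify over all index types; but passing to
  the image filter on the type of subsets of the group changes neither the Foelner property nor
  the upper density, so it suffices to take that type as index type and the identity as the net.
  That no Foelner net of any index type is lost is the first lemma below. The second one says that
  for a countable group the supremum over Foelner sequences gives the same value.
\<close>

definition upper_banach_density :: "('a, 'b) monoid_scheme \<Rightarrow> 'a set \<Rightarrow> ereal" where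
  "upper_banach_density G A =
     (SUP \<Phi> \<in> {\<Phi> :: 'a set filter. foelner_net G \<Phi> (\<lambda>F. F)}. upper_density_along \<Phi> (\<lambda>F. F) A)"

lemma upper_density_along_le_upper_banach_density:
  fixes \<Phi> :: "'i filter"
  assumes "foelner_net G \<Phi> F"
  shows "upper_density_along \<Phi> F A \<le> upper_banach_density G A"
proof -
  have "foelner_net G (filtermap F \<Phi>) (\<lambda>X. X)"
    using assms by (auto simp: foelner_net_def filtermap_bot_iff eventually_filtermap filterlim_filtermap)
  moreover have "upper_density_along \<Phi> F A \<le> upper_density_along (filtermap F \<Phi>) (\<lambda>X. X) A"
    unfolding upper_density_along_def by (rule Limsup_filtermap_ge)
  ultimately show ?thesis
    unfolding upper_banach_density_def by (meson SUP_upper2 mem_Collect_eq)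
qed

lemma upper_banach_density_countable:
  assumes "countable (carrier G)" "carrier G \<noteq> {}"
  shows "upper_banach_density G A =
    (SUP F \<in> {F :: nat \<Rightarrow> 'a set. foelner_net G sequentially F}. upper_density_along sequentially F A)"
    (is "_ = ?S")
proof (rule antisym)
  show "?S \<le> upper_banach_density G A"
    by (intro SUP_least) (auto intro: upper_density_along_le_upper_banach_density)
  have "upper_density_along \<Phi> (\<lambda>F. F) A \<le> ?S" if \<Phi>: "foelner_net G \<Phi> (\<lambda>F. F)" for \<Phi>
  proof (rule dense_le)
    fix y assume y: "y < upper_density_along \<Phi> (\<lambda>F. F) A"
    let ?d = "\<lambda>F. ereal (real (card (A \<inter> F)) / real (card F))"
    let ?r = "\<lambda>g F. real (card (sym_diff (g <#\<^bsub>G\<^esub> F) F)) / real (card F)"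
    have freq: "\<not> eventually (\<lambda>F. ?d F \<le> y) \<Phi>"
      using y Limsup_bounded[of ?d y \<Phi>] by (auto simp: upper_density_along_def)
    define e where "e = from_nat_into (carrier G)"
    have e: "range e = carrier G"
      unfolding e_def using assms by (rule range_from_nat_into[rotated])
    have "\<exists>F. y < ?d F \<and> finite F \<and> F \<noteq> {} \<and> F \<subseteq> carrier G \<and> (\<forall>k\<le>n. ?r (e k) F < inverse (real (Suc n)))" for n
    proof -
      have "eventually (\<lambda>F. ?r (e k) F < inverse (real (Suc n))) \<Phi>" for k
      proof -
        have "e k \<in> carrier G" using e by auto
        then have "((\<lambda>F. ?r (e k) F) \<longlongrightarrow> 0) \<Phi>" using \<Phi> by (auto simp: foelner_net_def)
        then show ?thesis by (rule order_tendstoD(2)) simp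
      qed
      then have "eventually (\<lambda>F. \<forall>k\<in>{..n}. ?r (e k) F < inverse (real (Suc n))) \<Phi>"
        by (intro eventually_ball_finite) auto
      moreover have "eventually (\<lambda>F. finite F \<and> F \<noteq> {} \<and> F \<subseteq> carrier G) \<Phi>"
        using \<Phi> by (auto simp: foelner_net_def)
      ultimately have ev: "eventually (\<lambda>F. finite F \<and> F \<noteq> {} \<and> F \<subseteq> carrier G \<and>
          (\<forall>k\<le>n. ?r (e k) F < inverse (real (Suc n)))) \<Phi>"
        by eventually_elim auto
      show ?thesis
      proof (rule ccontr)
        assume "\<not> ?thesis"
        then have "eventually (\<lambda>F. ?d F \<le> y) \<Phi>"
          by (intro eventually_mono[OF ev]) (meson not_le)
        with freq show False by simp
      qed
    qed
    then obtain F where F: "\<And>n. y < ?d (F n)" "\<And>n. finite (F n) \<and> F n \<noteq> {} \<and> F n \<subseteq> carrier G"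
      "\<And>n k. k \<le> n \<Longrightarrow> ?r (e k) (F n) < inverse (real (Suc n))" by metis
    have "(\<lambda>n. ?r g (F n)) \<longlonglongrightarrow> 0" if g: "g \<in> carrier G" for g
    proof -
      obtain k where k: "g = e k" using g e by blast
      have "eventually (\<lambda>n. ?r g (F n) \<le> inverse (real (Suc n))) sequentially"
        using eventually_ge_at_top[of k] by eventually_elim (use F(3) k in \<open>auto intro: less_imp_le\<close>)
      then show ?thesis
        by (rule tendsto_sandwich[OF _ _ tendsto_const LIMSEQ_inverse_real_of_nat, rotated]) simp
    qed
    with F(2) have "foelner_net G sequentially F" by (auto simp: foelner_net_def)
    moreover have "y \<le> upper_density_along sequentially F A"
      unfolding upper_density_along_def using F(1)
      by (intro le_Limsup always_eventually allI less_imp_le) simp_all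
    ultimately show "y \<le> ?S" by (meson SUP_upper2 mem_Collect_eq)
  qed
  then show "upper_banach_density G A \<le> ?S"
    unfolding upper_banach_density_def by (intro SUP_least) auto
qed

end

theory Submission
  imports Defs "HOL-Library.Ramsey"
begin

text \<open>
  The counting densities along a Foelner net with \<open>A\<close> of positive upper density cluster, by
  Tychonoff's theorem, at an invariant mean \<open>\<mu>\<close> with \<open>\<mu> A > 0\<close>. All the sets
  \<open>{c. b \<cdot> c \<in> A}\<close> have this same measure, so infinitely many of them have the property that finite
  intersections have positive measure and hence are infinite. This yields sequences of distinct
  elements with \<open>b\<^sub>i \<cdot> c\<^sub>j \<in> A\<close> for \<open>i \<le> j\<close>. By Ramsey's theorem one can pass to a subsequence on which
  either all \<open>b\<^sub>i \<cdot> c\<^sub>j\<close> or none of them are in \<open>A\<close> for \<open>j < i\<close>; stability excludes the latter.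
\<close>

section \<open>Finitely additive measures and Bergelson's intersectivity lemma\<close>

locale finitely_additive =
  fixes \<Omega> :: "'a set" and \<mu> :: "'a set \<Rightarrow> real"
  assumes nonneg: "X \<subseteq> \<Omega> \<Longrightarrow> 0 \<le> \<mu> X"
    and disjoint_Un: "X \<subseteq> \<Omega> \<Longrightarrow> Y \<subseteq> \<Omega> \<Longrightarrow> X \<inter> Y = {} \<Longrightarrow> \<mu> (X \<union> Y) = \<mu> X + \<mu> Y"
begin

lemma measure_empty: "\<mu> {} = 0"
  using disjoint_Un[of "{}" "{}"] by simp

lemma measure_split:
  assumes "X \<subseteq> \<Omega>"
  shows "\<mu> X = \<mu> (X \<inter> Y) + \<mu> (X - Y)"
  using disjoint_Un[of "X \<inter> Y" "X - Y"] assms by (simp add: Int_Diff_Un Int_Diff_disjoint le_infI1 Diff_subset_conv le_supI2)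

lemma measure_mono:
  assumes "X \<subseteq> Y" "Y \<subseteq> \<Omega>"
  shows "\<mu> X \<le> \<mu> Y"
proof -
  have "Y \<inter> X = X" using assms by auto
  then show ?thesis using measure_split[of Y X] nonneg[of "Y - X"] assms by auto
qed

lemma measure_Un_Int:
  assumes "X \<subseteq> \<Omega>" "Y \<subseteq> \<Omega>"
  shows "\<mu> (X \<union> Y) + \<mu> (X \<inter> Y) = \<mu> X + \<mu> Y"
proof -
  have "\<mu> (X \<union> Y) = \<mu> X + \<mu> (Y - X)"
    using disjoint_Un[of X "Y - X"] assms by auto
  then show ?thesis using measure_split[of Y X] assms by (simp add: Int_commute)
qed

lemma measure_UN_le:
  assumes "finite S" "\<And>i. i \<in> S \<Longrightarrow> E i \<subseteq> \<Omega>"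
  shows "\<mu> (\<Union>i\<in>S. E i) \<le> (\<Sum>i\<in>S. \<mu> (E i))"
  using assms
proof (induction S)
  case empty
  then show ?case by (simp add: measure_empty)
next
  case (insert i S)
  then have sub: "E i \<subseteq> \<Omega>" "(\<Union>i\<in>S. E i) \<subseteq> \<Omega>" by auto
  then have "0 \<le> \<mu> (E i \<inter> (\<Union>i\<in>S. E i))" by (intro nonneg) auto
  moreover have "\<mu> (\<Union>i\<in>S. E i) \<le> (\<Sum>i\<in>S. \<mu> (E i))" using insert by simp
  ultimately show ?case using insert(1,2) measure_Un_Int[OF sub] by simp
qed

text \<open>By subadditivity, a set \<open>E j\<close> that meets the union in measure at least
  \<epsilon> must meet one of its finitely many members in a fixed fraction of \<epsilon>. So
  finitely many finite index sets cover the one in question. The \<open>+ 1\<close> in the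
  denominator of \<delta> makes the sum of the small overlaps strictly less than \<epsilon>, also
  for empty \<open>S\<close>.\<close>

lemma finite_large_intersections_UN:
  assumes "finite S" "\<And>i. E i \<subseteq> \<Omega>" "\<epsilon> > 0"
    and fin: "\<And>i \<delta>. i \<in> S \<Longrightarrow> \<delta> > 0 \<Longrightarrow> finite {j \<in> I. \<delta> \<le> \<mu> (E i \<inter> E j)}"
  shows "finite {j \<in> I. \<epsilon> \<le> \<mu> ((\<Union>i\<in>S. E i) \<inter> E j)}"
proof -
  define \<delta> where "\<delta> = \<epsilon> / (real (card S) + 1)"
  have \<delta>: "\<delta> > 0" "real (card S) * \<delta> < \<epsilon>"
    using \<open>\<epsilon> > 0\<close> by (auto simp: \<delta>_def field_simps)
  have "{j \<in> I. \<epsilon> \<le> \<mu> ((\<Union>i\<in>S. E i) \<inter> E j)} \<subseteq> (\<Union>i\<in>S. {j \<in> I. \<delta> \<le> \<mu> (E i \<inter> E j)})"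
  proof clarify
    fix j assume j: "j \<in> I" "\<epsilon> \<le> \<mu> ((\<Union>i\<in>S. E i) \<inter> E j)"
    show "j \<in> (\<Union>i\<in>S. {j \<in> I. \<delta> \<le> \<mu> (E i \<inter> E j)})"
    proof (rule ccontr)
      assume "\<not> ?thesis"
      with j have less: "\<mu> (E i \<inter> E j) \<le> \<delta>" if "i \<in> S" for i using that by force
      have "\<mu> ((\<Union>i\<in>S. E i) \<inter> E j) \<le> (\<Sum>i\<in>S. \<mu> (E i \<inter> E j))"
        using measure_UN_le[OF \<open>finite S\<close>, of "\<lambda>i. E i \<inter> E j"] assms(2) by (simp add: Int_UN_distrib2 le_infI1)
      also have "\<dots> \<le> real (card S) * \<delta>"
        using sum_bounded_above[of S "\<lambda>i. \<mu> (E i \<inter> E j)" \<delta>] less by simp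
      finally show False using j \<delta> by simp
    qed
  qed
  with assms(1) fin \<delta>(1) show ?thesis by (meson finite_UN_I finite_subset)
qed

lemma infinite_large_intersections:
  assumes "infinite I" "\<And>i. E i \<subseteq> \<Omega>" "\<epsilon> > 0" and large: "\<And>i. i \<in> I \<Longrightarrow> \<epsilon> \<le> \<mu> (E i)"
  shows "\<exists>i\<in>I. \<exists>\<delta>>0. infinite {j \<in> I. \<delta> \<le> \<mu> (E i \<inter> E j)}"
proof (rule ccontr)
  assume neg: "\<not> ?thesis"
  text \<open>Otherwise the sets are almost disjoint, and unions of them have unbounded measure.\<close>
  have "\<exists>S\<subseteq>I. finite S \<and> real n * (\<epsilon> / 2) \<le> \<mu> (\<Union>i\<in>S. E i)" for n
  proof (induction n)
    case 0
    show ?case by (intro exI[of _ "{}"]) (simp add: measure_empty)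
  next
    case (Suc n)
    then obtain S where S: "S \<subseteq> I" "finite S" "real n * (\<epsilon> / 2) \<le> \<mu> (\<Union>i\<in>S. E i)" by blast
    \<comment> \<open>Half of \<epsilon> may be lost to overlap, so that each further set adds at
      least the other half. The index \<open>j\<close> found below is automatically new: for
      \<open>j\<close> in \<open>S\<close> the overlap would be all of \<open>E j\<close>.\<close>
    have "finite {j \<in> I. \<epsilon> / 2 \<le> \<mu> ((\<Union>i\<in>S. E i) \<inter> E j)}"
      using neg S assms by (intro finite_large_intersections_UN) auto
    then obtain j where j: "j \<in> I" "\<mu> ((\<Union>i\<in>S. E i) \<inter> E j) < \<epsilon> / 2"
      using \<open>infinite I\<close> by (metis (mono_tags, lifting) finite_subset mem_Collect_eq not_le subsetI)
    have "\<mu> ((\<Union>i\<in>S. E i) \<union> E j) + \<mu> ((\<Union>i\<in>S. E i) \<inter> E j) = \<mu> (\<Union>i\<in>S. E i) + \<mu> (E j)"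
      using assms(2) by (intro measure_Un_Int) auto
    moreover have "\<epsilon> \<le> \<mu> (E j)" using large j by simp
    ultimately have "real (Suc n) * (\<epsilon> / 2) \<le> \<mu> (\<Union>i\<in>insert j S. E i)"
      using S(3) j(2) by (simp add: Un_commute field_simps)
    then show ?case using S j by (intro exI[of _ "insert j S"]) auto
  qed
  moreover have "\<mu> (\<Union>i\<in>S. E i) \<le> \<mu> \<Omega>" for S
    using assms(2) by (intro measure_mono) auto
  ultimately have "real n * (\<epsilon> / 2) \<le> \<mu> \<Omega>" for n by (meson order_trans)
  moreover obtain n where "\<mu> \<Omega> < real n * (\<epsilon> / 2)"
    using reals_Archimedean3[of "\<epsilon> / 2"] \<open>\<epsilon> > 0\<close> by auto
  ultimately show False by (meson not_le)
qed

text \<open>The sequence is built by repeatedly applying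
  \<open>infinite_large_intersections\<close>, not to the sets \<open>E j\<close> themselves but to
  their traces on the intersection chosen so far.\<close>

lemma intersectivity:
  assumes "infinite I" "\<And>i. E i \<subseteq> \<Omega>" "\<epsilon> > 0" "\<And>i. i \<in> I \<Longrightarrow> \<epsilon> \<le> \<mu> (E i)"
  shows "\<exists>b :: nat \<Rightarrow> 'i. inj b \<and> range b \<subseteq> I \<and> (\<forall>n. 0 < \<mu> (\<Inter>k\<le>n. E (b k)))"
proof -
  \<comment> \<open>In a state \<open>(J, Y)\<close>, \<open>Y\<close> is the current intersection
    and \<open>J\<close> the infinite reservoir of indices still available. The uniform lower bound
    \<delta> may shrink from state to state, so it is quantified inside \<open>P\<close>. A step
    along \<open>Q\<close> spends one index of \<open>J\<close> and never offers it again, which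
    will make \<open>b\<close> injective.\<close>
  define P where "P = (\<lambda>(J, Y). infinite J \<and> J \<subseteq> I \<and> Y \<subseteq> \<Omega> \<and> (\<exists>\<delta>>0. \<forall>j\<in>J. \<delta> \<le> \<mu> (Y \<inter> E j)))"
  define Q where "Q = (\<lambda>(J, Y) (J', Y'). \<exists>i\<in>J. J' \<subseteq> J - {i} \<and> Y' = Y \<inter> E i)"
  have "P (I, \<Omega>)"
    using assms by (auto simp: P_def Int_absorb1)
  moreover have "\<exists>y. P y \<and> Q x y" if Px: "P x" for x
  proof -
    obtain J Y where x: "x = (J, Y)" by (cases x)
    with Px obtain \<delta> where J: "infinite J" "J \<subseteq> I" "Y \<subseteq> \<Omega>" "\<delta> > 0" "\<And>j. j \<in> J \<Longrightarrow> \<delta> \<le> \<mu> (Y \<inter> E j)"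
      by (auto simp: P_def)
    then obtain i \<delta>' where i: "i \<in> J" "\<delta>' > 0" "infinite {j \<in> J. \<delta>' \<le> \<mu> ((Y \<inter> E i) \<inter> (Y \<inter> E j))}"
      using infinite_large_intersections[of J "\<lambda>j. Y \<inter> E j" \<delta>] by blast
    let ?J = "{j \<in> J. \<delta>' \<le> \<mu> ((Y \<inter> E i) \<inter> (Y \<inter> E j))} - {i}"
    have "(Y \<inter> E i) \<inter> (Y \<inter> E j) = (Y \<inter> E i) \<inter> E j" for j by auto
    with i J have "P (?J, Y \<inter> E i)" by (auto simp: P_def)
    moreover have "Q x (?J, Y \<inter> E i)" using i x by (auto simp: Q_def)
    ultimately show ?thesis by blast
  qed
  ultimately obtain f where f: "\<And>n :: nat. P (f n)" "\<And>n. Q (f n) (f (Suc n))"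
    using dependent_nat_choice[of "\<lambda>_. P" "\<lambda>_. Q"] by metis
  define J where "J n = fst (f n)" for n
  define Y where "Y n = snd (f n)" for n
  have PJ: "infinite (J n)" "J n \<subseteq> I" "Y n \<subseteq> \<Omega>" "\<exists>\<delta>>0. \<forall>j\<in>J n. \<delta> \<le> \<mu> (Y n \<inter> E j)" for n
    using f(1)[of n] by (auto simp: P_def J_def Y_def case_prod_beta)
  obtain b where b: "\<And>n. b n \<in> J n" "\<And>n. J (Suc n) \<subseteq> J n - {b n}" "\<And>n. Y (Suc n) = Y n \<inter> E (b n)"
    using f(2) unfolding Q_def J_def Y_def case_prod_beta by metis
  have decr: "J n \<subseteq> J m" if "m \<le> n" for m n
    using that b(2) by (induction rule: dec_induct) auto
  have "b m \<noteq> b n" if "m < n" for m n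
    using decr[of "Suc m" n] that b(1)[of n] b(2)[of m] by auto
  then have "inj b" by (metis injI linorder_neqE_nat)
  moreover have "range b \<subseteq> I" using b(1) PJ(2) by auto
  moreover have "0 < \<mu> (\<Inter>k\<le>n. E (b k))" for n
  proof -
    \<comment> \<open>Only an inclusion: the choice principle does not record the initial state, so
      \<open>Y 0\<close> may be any set allowed by \<open>P\<close>.\<close>
    have "Y (Suc n) \<subseteq> (\<Inter>k\<le>n. E (b k))"
    proof (induction n)
      case (Suc n)
      then show ?case using b(3)[of "Suc n"] by (auto simp: atMost_Suc)
    qed (simp add: b(3))
    moreover obtain \<delta> where \<delta>: "\<delta> > 0" "\<And>j. j \<in> J n \<Longrightarrow> \<delta> \<le> \<mu> (Y n \<inter> E j)"
      using PJ(4) by blast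
    then have "0 < \<mu> (Y (Suc n))" using b(1)[of n] b(3)[of n] by fastforce
    moreover have "(\<Inter>k\<le>n. E (b k)) \<subseteq> \<Omega>" using assms(2) by blast
    ultimately show ?thesis using measure_mono by (meson less_le_trans)
  qed
  ultimately show ?thesis by blast
qed

end

section \<open>Invariant means and finite sets\<close>

lemma invariant_mean_finitely_additive:
  "invariant_mean G \<mu> \<Longrightarrow> finitely_additive (carrier G) \<mu>"
  by unfold_locales (auto simp: invariant_mean_def)

lemma (in group) invariant_mean_singleton:
  assumes "invariant_mean G \<mu>" "x \<in> carrier G"
  shows "\<mu> {x} = \<mu> {\<one>}"
proof -
  have "x <#\<^bsub>G\<^esub> {\<one>} = {x}" using assms by (auto simp: l_coset_def)
  then show ?thesis using assms by (metis empty_subsetI insert_subset invariant_mean_def one_closed)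
qed

text \<open>Translation gives all points the same mass, and arbitrarily many of them fit into the
  group, whose mass is a fixed real. Hence this common mass is zero.\<close>

lemma (in group) invariant_mean_finite:
  assumes "invariant_mean G \<mu>" "infinite (carrier G)" "X \<subseteq> carrier G" "finite X"
  shows "\<mu> X = 0"
proof -
  interpret finitely_additive "carrier G" \<mu>
    using assms(1) by (rule invariant_mean_finitely_additive)
  have card: "\<mu> Y = real (card Y) * \<mu> {\<one>}" if "finite Y" "Y \<subseteq> carrier G" for Y
    using that
  proof (induction Y)
    case (insert y Y)
    then show ?case
      using disjoint_Un[of "{y}" Y] invariant_mean_singleton[OF assms(1), of y]
      by (simp add: algebra_simps)
  qed (simp add: measure_empty)
  have bound: "real n * \<mu> {\<one>} \<le> \<mu> (carrier G)" for n
  proof -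
    obtain Y where "finite Y" "card Y = n" "Y \<subseteq> carrier G"
      using assms(2) infinite_arbitrarily_large by blast
    then show ?thesis using card[of Y] measure_mono[of Y "carrier G"] by simp
  qed
  have "\<not> 0 < \<mu> {\<one>}"
    using bound reals_Archimedean3 by (meson not_le)
  then have "\<mu> {\<one>} = 0" using nonneg[of "{\<one>}"] by simp
  then show ?thesis using card[OF assms(4,3)] by simp
qed

section \<open>From Foelner nets to invariant means, by compactness\<close>

lemma compact_cube: "compact {m :: 'i \<Rightarrow> real. \<forall>i. m i \<in> {0..1}}"
proof -
  have "{m :: 'i \<Rightarrow> real. \<forall>i. m i \<in> {0..1}} = (\<Pi>\<^sub>E i\<in>UNIV. {0..1})"
    by (auto simp: PiE_def Pi_def)
  moreover have "compactin (product_topology (\<lambda>i::'i. euclidean) UNIV) (\<Pi>\<^sub>E i\<in>UNIV. {0..1::real})"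
    by (simp add: compactin_PiE)
  ultimately show ?thesis by (simp add: euclidean_product_topology)
qed

text \<open>A finer filter plays the role of a subnet. Seen as a map into the compact cube,
  \<open>D\<close> has a cluster point \<open>m\<close> along \<Phi>; adding the preimages of the
  neighbourhoods of \<open>m\<close> to \<Phi> forces convergence in all coordinates at
  once.\<close>

lemma unit_interval_family_subnet:
  fixes D :: "'i \<Rightarrow> 'j \<Rightarrow> real"
  assumes "\<Phi> \<noteq> bot" "\<And>i j. D i j \<in> {0..1}"
  shows "\<exists>\<Psi> m. \<Psi> \<noteq> bot \<and> \<Psi> \<le> \<Phi> \<and> (\<forall>j. ((\<lambda>i. D i j) \<longlongrightarrow> m j) \<Psi>)"
proof -
  have "filtermap D \<Phi> \<noteq> bot" "eventually (\<lambda>m. m \<in> {m. \<forall>i. m i \<in> {0..1}}) (filtermap D \<Phi>)"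
    using assms by (auto simp: filtermap_bot_iff eventually_filtermap)
  then obtain m where m: "inf (nhds m) (filtermap D \<Phi>) \<noteq> bot"
    using compact_cube[where 'i = 'j] unfolding compact_filter by blast
  define \<Psi> where "\<Psi> = inf \<Phi> (filtercomap D (nhds m))"
  \<comment> \<open>Triviality would give a neighbourhood of \<open>m\<close> that \<open>D\<close>
    eventually avoids along \<Phi>, so \<open>m\<close> would not be a cluster point.\<close>
  have "\<Psi> \<noteq> bot"
  proof
    assume "\<Psi> = bot"
    then have "eventually (\<lambda>_. False) \<Psi>" by simp
    then obtain P R where PR: "eventually P \<Phi>" "eventually R (nhds m)" "\<And>i. P i \<Longrightarrow> R (D i) \<Longrightarrow> False"
      unfolding \<Psi>_def eventually_inf eventually_filtercomap by blast
    then have "eventually (\<lambda>m. \<not> R m) (filtermap D \<Phi>)"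
      unfolding eventually_filtermap by (blast intro: eventually_mono)
    with PR(2) have "eventually (\<lambda>_. False) (inf (nhds m) (filtermap D \<Phi>))"
      unfolding eventually_inf by blast
    with m show False by (simp add: eventually_False)
  qed
  moreover have "((\<lambda>i. D i j) \<longlongrightarrow> m j) \<Psi>" for j
  proof -
    have "(D \<longlongrightarrow> m) \<Psi>"
      unfolding \<Psi>_def by (rule tendsto_mono[OF inf_le2 filterlim_filtercomap])
    then show ?thesis
      by (rule continuous_on_tendsto_compose[OF continuous_on_product_coordinates]) auto
  qed
  moreover have "\<Psi> \<le> \<Phi>" by (simp add: \<Psi>_def)
  ultimately show ?thesis by blast
qed

text \<open>Left multiplication by \<open>g\<close> is a bijection between the two sets. It moves
  the translation from \<open>X\<close> to \<open>F\<close>, where the Foelner condition can control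
  it.\<close>

lemma (in group) card_l_coset_Int:
  assumes "g \<in> carrier G" "X \<subseteq> carrier G" "F \<subseteq> carrier G"
  shows "card ((g <#\<^bsub>G\<^esub> X) \<inter> F) = card (X \<inter> (inv g <#\<^bsub>G\<^esub> F))"
proof -
  have "(\<lambda>x. g \<otimes> x) ` (X \<inter> (inv g <#\<^bsub>G\<^esub> F)) = (g <#\<^bsub>G\<^esub> X) \<inter> F"
  proof (intro equalityI subsetI)
    fix y assume "y \<in> (\<lambda>x. g \<otimes> x) ` (X \<inter> (inv g <#\<^bsub>G\<^esub> F))"
    then obtain f where f: "f \<in> F" "inv g \<otimes> f \<in> X" "y = g \<otimes> (inv g \<otimes> f)"
      by (auto simp: l_coset_def)
    then have "y = f"
      using assms by (simp add: m_assoc[symmetric] subset_iff)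
    with f(1) show "y \<in> (g <#\<^bsub>G\<^esub> X) \<inter> F"
      using f(2,3) unfolding l_coset_def by blast
  next
    fix y assume "y \<in> (g <#\<^bsub>G\<^esub> X) \<inter> F"
    then obtain x where x: "x \<in> X" "y = g \<otimes> x" "y \<in> F" by (auto simp: l_coset_def)
    then have "x = inv g \<otimes> y" using assms by (auto simp: m_assoc[symmetric] subset_iff)
    then show "y \<in> (\<lambda>x. g \<otimes> x) ` (X \<inter> (inv g <#\<^bsub>G\<^esub> F))"
      using x unfolding l_coset_def by blast
  qed
  moreover have "inj_on (\<lambda>x. g \<otimes> x) (X \<inter> (inv g <#\<^bsub>G\<^esub> F))"
    using assms by (auto intro!: inj_onI simp: subset_iff)
  ultimately show ?thesis by (metis card_image)
qed

lemma (in group) card_l_coset_Int_diff_le: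
  assumes "g \<in> carrier G" "X \<subseteq> carrier G" "F \<subseteq> carrier G" "finite F"
  shows "\<bar>real (card ((g <#\<^bsub>G\<^esub> X) \<inter> F)) - real (card (X \<inter> F))\<bar>
    \<le> real (card (sym_diff (inv g <#\<^bsub>G\<^esub> F) F))"
proof -
  let ?H = "inv g <#\<^bsub>G\<^esub> F"
  have "finite ?H" using assms(4) by (simp add: l_coset_def)
  then have "card (X \<inter> ?H) \<le> card ((X \<inter> F) \<union> sym_diff ?H F)"
    "card (X \<inter> F) \<le> card ((X \<inter> ?H) \<union> sym_diff ?H F)"
    using assms(4) by (auto intro!: card_mono)
  then have "card (X \<inter> ?H) \<le> card (X \<inter> F) + card (sym_diff ?H F)"
    "card (X \<inter> F) \<le> card (X \<inter> ?H) + card (sym_diff ?H F)"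
    using card_Un_le order_trans by blast+
  then show ?thesis using card_l_coset_Int[OF assms(1-3)] by linarith
qed

text \<open>Normalisation and additivity hold exactly for the counting measure on each finite
  nonempty \<open>F i\<close> inside the group, and pass to the limit. Invariance holds up to an
  error bounded by the Foelner ratio of \<open>inv g\<close>, which tends to 0.\<close>

lemma (in group) foelner_net_invariant_mean:
  assumes "foelner_net G \<Phi> F"
    and lim: "\<And>X. ((\<lambda>i. real (card (X \<inter> F i)) / real (card (F i))) \<longlongrightarrow> \<mu> X) \<Phi>"
  shows "invariant_mean G \<mu>"
proof -
  let ?d = "\<lambda>X i. real (card (X \<inter> F i)) / real (card (F i))"
  have [simp]: "\<Phi> \<noteq> bot"
    and ev: "eventually (\<lambda>i. finite (F i) \<and> F i \<noteq> {} \<and> F i \<subseteq> carrier G) \<Phi>"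
    using assms(1) by (auto simp: foelner_net_def)
  have "0 \<le> \<mu> X" for X
    by (rule tendsto_lowerbound[OF lim]) auto
  moreover have "\<mu> (carrier G) = 1"
  proof (rule tendsto_unique[OF _ lim])
    have "eventually (\<lambda>i. 1 = ?d (carrier G) i) \<Phi>"
      using ev by eventually_elim (auto simp: Int_absorb1)
    then show "(?d (carrier G) \<longlongrightarrow> 1) \<Phi>" by (rule Lim_transform_eventually[OF tendsto_const])
  qed simp
  moreover have "\<mu> (X \<union> Y) = \<mu> X + \<mu> Y" if "X \<inter> Y = {}" for X Y
  proof (rule tendsto_unique[OF _ lim])
    have "eventually (\<lambda>i. ?d X i + ?d Y i = ?d (X \<union> Y) i) \<Phi>"
      using ev
    proof eventually_elim
      case (elim i)
      then have "card ((X \<union> Y) \<inter> F i) = card (X \<inter> F i) + card (Y \<inter> F i)"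
        using that by (subst card_Un_disjoint[symmetric]) (auto simp: Int_Un_distrib2)
      then show ?case by (simp add: add_divide_distrib)
    qed
    then show "(?d (X \<union> Y) \<longlongrightarrow> \<mu> X + \<mu> Y) \<Phi>"
      by (rule Lim_transform_eventually[OF tendsto_add[OF lim lim]])
  qed simp
  moreover have "\<mu> (g <#\<^bsub>G\<^esub> X) = \<mu> X" if g: "g \<in> carrier G" and X: "X \<subseteq> carrier G" for g X
  proof -
    let ?s = "\<lambda>i. real (card (sym_diff (inv g <#\<^bsub>G\<^esub> F i) (F i))) / real (card (F i))"
    have "(?s \<longlongrightarrow> 0) \<Phi>" using assms(1) g by (auto simp: foelner_net_def)
    moreover have "eventually (\<lambda>i. norm (?d (g <#\<^bsub>G\<^esub> X) i - ?d X i) \<le> ?s i) \<Phi>"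
      using ev
    proof eventually_elim
      case (elim i)
      then show ?case
        using card_l_coset_Int_diff_le[OF g X, of "F i"]
        by (simp add: diff_divide_distrib[symmetric] abs_divide divide_right_mono)
    qed
    ultimately have "((\<lambda>i. ?d (g <#\<^bsub>G\<^esub> X) i - ?d X i) \<longlongrightarrow> 0) \<Phi>"
      by (rule Lim_null_comparison[rotated])
    then have "\<mu> (g <#\<^bsub>G\<^esub> X) - \<mu> X = 0"
      by (rule tendsto_unique[rotated 2]) (auto intro: tendsto_diff lim)
    then show ?thesis by simp
  qed
  ultimately show ?thesis by (auto simp: invariant_mean_def)
qed

lemma foelner_net_mono:
  "foelner_net G \<Phi> F \<Longrightarrow> \<Psi> \<le> \<Phi> \<Longrightarrow> \<Psi> \<noteq> bot \<Longrightarrow> foelner_net G \<Psi> F"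
  unfolding foelner_net_def by (meson filter_leD tendsto_mono)

lemma (in group) upper_banach_density_pos_invariant_mean:
  assumes "0 < upper_banach_density G A"
  shows "\<exists>\<mu>. invariant_mean G \<mu> \<and> 0 < \<mu> A"
proof -
  let ?d = "\<lambda>F X. real (card (X \<inter> F)) / real (card F)"
  obtain \<Phi> where \<Phi>: "foelner_net G \<Phi> (\<lambda>F. F)" "0 < upper_density_along \<Phi> (\<lambda>F. F) A"
    using assms by (auto simp: upper_banach_density_def less_SUP_iff)
  then obtain r where r: "0 < r" "r < upper_density_along \<Phi> (\<lambda>F. F) A"
    using dense by blast
  \<comment> \<open>The bound \<open>r\<close> is an extended real; a positive real below it is
    needed for comparison with \<mu>.\<close>
  obtain s where s: "0 < s" "ereal s \<le> r"
    using r(1) by (metis ereal_dense2 ereal_less(2) less_imp_le)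
  have freq: "\<not> eventually (\<lambda>F. ?d F A \<le> s) \<Phi>"
  proof
    assume "eventually (\<lambda>F. ?d F A \<le> s) \<Phi>"
    then have "upper_density_along \<Phi> (\<lambda>F. F) A \<le> ereal s"
      unfolding upper_density_along_def by (intro Limsup_bounded) simp
    with r s show False by (meson not_le order_trans)
  qed
  \<comment> \<open>Before compactness is applied, the net is cut down to the sets in which
    \<open>A\<close> has density at least \<open>s\<close>. An arbitrary cluster point of the
    original net could give \<open>A\<close> mass 0. The restriction is nontrivial because the upper
    density exceeds \<open>s\<close>.\<close>
  define \<Phi>' where "\<Phi>' = inf \<Phi> (principal {F. s \<le> ?d F A})"
  have "\<Phi>' \<noteq> bot"
  proof
    assume "\<Phi>' = bot"
    then have "eventually (\<lambda>F. \<not> s \<le> ?d F A) \<Phi>"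
      by (simp add: \<Phi>'_def trivial_limit_def eventually_inf_principal)
    then have "eventually (\<lambda>F. ?d F A \<le> s) \<Phi>" by eventually_elim simp
    with freq show False by simp
  qed
  \<comment> \<open>This covers every \<open>F\<close>: if \<open>F\<close> is infinite or empty,
    the denominator is 0 and the quotient is 0 by convention.\<close>
  moreover have "?d F X \<in> {0..1}" for F X
    by (cases "finite F") (auto intro!: divide_le_eq_1[THEN iffD2] card_mono simp: card_gt_0_iff)
  ultimately obtain \<Psi> \<mu> where \<Psi>: "\<Psi> \<noteq> bot" "\<Psi> \<le> \<Phi>'" "\<And>X. ((\<lambda>F. ?d F X) \<longlongrightarrow> \<mu> X) \<Psi>"
    using unit_interval_family_subnet[of \<Phi>' ?d] by blast
  have "\<Psi> \<le> \<Phi>" using \<Psi>(2) by (simp add: \<Phi>'_def)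
  then have "invariant_mean G \<mu>"
    using \<Phi>(1) \<Psi> foelner_net_mono by (intro foelner_net_invariant_mean[of \<Psi> "\<lambda>F. F"]) auto
  moreover have "s \<le> \<mu> A"
  proof (rule tendsto_lowerbound[OF \<Psi>(3)])
    have "eventually (\<lambda>F. s \<le> ?d F A) \<Phi>'" by (simp add: \<Phi>'_def eventually_inf_principal)
    then show "eventually (\<lambda>F. s \<le> ?d F A) \<Psi>" using \<Psi>(2) by (simp add: filter_leD)
  qed (fact \<Psi>(1))
  ultimately show ?thesis using s by auto
qed

section \<open>Choosing sequences, Ramsey's theorem and stability\<close>

lemma infinite_sets_distinct_representatives:
  fixes Z :: "nat \<Rightarrow> 'a set"
  assumes "\<And>n. infinite (Z n)"
  shows "\<exists>c. inj c \<and> (\<forall>n. c n \<in> Z n)"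
proof -
  have "\<exists>c. \<forall>n. c n \<in> Z n - c ` {..<n}"
  proof (rule dependent_wellorder_choice)
    show "\<exists>r. r \<in> Z n - c ` {..<n}" for n and c :: "nat \<Rightarrow> 'a"
      using assms[of n] by (metis all_not_in_conv finite.emptyI finite_Diff2 finite_imageI finite_lessThan)
  qed (auto simp: image_def)
  then obtain c where c: "\<And>n. c n \<in> Z n - c ` {..<n}" by blast
  have "c m \<noteq> c n" if "m < n" for m n using c[of n] that by (metis DiffD2 imageI lessThan_iff)
  then have "inj c" by (metis injI linorder_neqE_nat)
  with c show ?thesis by blast
qed

text \<open>Only the truth of \<open>R i j\<close> for \<open>j < i\<close> is open. It is used to
  colour the pair \<open>{i, j}\<close>, and an infinite monochromatic set is enumerated
  increasingly: one colour gives the full relation, the other exactly the order.\<close>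

lemma half_graph_homogeneous:
  fixes R :: "nat \<Rightarrow> nat \<Rightarrow> bool"
  assumes "\<And>i j. i \<le> j \<Longrightarrow> R i j"
  shows "\<exists>h :: nat \<Rightarrow> nat. strict_mono h \<and> ((\<forall>i j. R (h i) (h j)) \<or> (\<forall>i j. R (h i) (h j) \<longleftrightarrow> i \<le> j))"
proof -
  define f :: "nat set \<Rightarrow> nat" where "f e = (if R (Max e) (Min e) then 1 else 0)" for e
  obtain Y t where Y: "infinite Y" "\<And>x y. x \<in> Y \<Longrightarrow> y \<in> Y \<Longrightarrow> x \<noteq> y \<Longrightarrow> f {x, y} = t"
    using Ramsey2[of UNIV f 2] by (metis f_def infinite_UNIV_nat one_less_numeral_iff semiring_norm(76) zero_less_numeral)
  define h where "h = enumerate Y"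
  have h: "strict_mono h" "\<And>i. h i \<in> Y"
    using Y(1) by (auto simp: h_def strict_mono_enumerate enumerate_in_set)
  have "R (h i) (h j) \<longleftrightarrow> t = 1" if "j < i" for i j
  proof -
    have "h j < h i" using h(1) that by (simp add: strict_monoD)
    then have "Max {h i, h j} = h i" "Min {h i, h j} = h j" "h i \<noteq> h j" by auto
    then show ?thesis using Y(2)[OF h(2)[of i] h(2)[of j]] by (auto simp: f_def split: if_splits)
  qed
  moreover have "R (h i) (h j)" if "i \<le> j" for i j
    using assms h(1) that by (simp add: strict_mono_less_eq)
  ultimately have "R (h i) (h j) \<longleftrightarrow> i \<le> j \<or> t = 1" for i j
    by (meson not_le)
  then have "(\<forall>i j. R (h i) (h j)) \<or> (\<forall>i j. R (h i) (h j) \<longleftrightarrow> i \<le> j)"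
    by (cases "t = 1") simp_all
  with h(1) show ?thesis by blast
qed

text \<open>Along the Ramsey subsequence \<open>h\<close>, the second alternative is literally the
  order property, witnessed by \<open>b \<circ> h\<close> and \<open>c \<circ> h\<close>. The first
  one makes their ranges the required sets, infinite by injectivity.\<close>

lemma (in group) stable_set_product_subset:
  fixes b c :: "nat \<Rightarrow> 'a"
  assumes "stable_set G A" "inj b" "inj c" "range b \<subseteq> carrier G" "range c \<subseteq> carrier G"
    and half: "\<And>i j. i \<le> j \<Longrightarrow> b i \<otimes> c j \<in> A"
  shows "\<exists>B C. B \<subseteq> carrier G \<and> C \<subseteq> carrier G \<and> infinite B \<and> infinite C \<and> B <#> C \<subseteq> A"
proof -
  obtain h :: "nat \<Rightarrow> nat" where h: "strict_mono h"
    "(\<forall>i j. b (h i) \<otimes> c (h j) \<in> A) \<or> (\<forall>i j. b (h i) \<otimes> c (h j) \<in> A \<longleftrightarrow> i \<le> j)"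
    using half_graph_homogeneous[of "\<lambda>i j. b i \<otimes> c j \<in> A"] half by blast
  have "\<not> (\<forall>i j. b (h i) \<otimes> c (h j) \<in> A \<longleftrightarrow> i \<le> j)"
  proof
    assume "\<forall>i j. b (h i) \<otimes> c (h j) \<in> A \<longleftrightarrow> i \<le> j"
    moreover have "range (b \<circ> h) \<subseteq> carrier G" "range (c \<circ> h) \<subseteq> carrier G" using assms by auto
    ultimately show False using assms(1) unfolding stable_set_def o_def by blast
  qed
  with h(2) have "range (b \<circ> h) <#> range (c \<circ> h) \<subseteq> A" by (auto simp: set_mult_def)
  moreover have "inj h" using h(1) by (rule strict_mono_imp_inj_on)
  then have "infinite (range (b \<circ> h))" "infinite (range (c \<circ> h))"
    using assms(2,3) by (meson range_inj_infinite inj_compose)+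
  moreover have "range (b \<circ> h) \<subseteq> carrier G" "range (c \<circ> h) \<subseteq> carrier G" using assms by auto
  ultimately show ?thesis by blast
qed

lemma (in group) invariant_mean_half_graph:
  assumes "invariant_mean G \<mu>" "infinite (carrier G)" "A \<subseteq> carrier G" "0 < \<mu> A"
  shows "\<exists>b c :: nat \<Rightarrow> 'a. inj b \<and> inj c \<and> range b \<subseteq> carrier G \<and> range c \<subseteq> carrier G \<and>
    (\<forall>i j. i \<le> j \<longrightarrow> b i \<otimes> c j \<in> A)"
proof -
  interpret finitely_additive "carrier G" \<mu>
    using assms(1) by (rule invariant_mean_finitely_additive)
  \<comment> \<open>\<open>E g\<close> is the translate of \<open>A\<close> by \<open>inv g\<close>,
    so all these sets have the measure of \<open>A\<close>.\<close>
  define E where "E g = {x \<in> carrier G. g \<otimes> x \<in> A}" for g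
  have "\<mu> (E g) = \<mu> A" if g: "g \<in> carrier G" for g
  proof -
    have "g <#\<^bsub>G\<^esub> E g = A"
    proof (intro equalityI subsetI)
      fix a assume a: "a \<in> A"
      then have "a = g \<otimes> (inv g \<otimes> a)" "inv g \<otimes> a \<in> carrier G"
        using g assms(3) by (auto simp: m_assoc[symmetric] subset_iff)
      with a show "a \<in> g <#\<^bsub>G\<^esub> E g" unfolding l_coset_def E_def by auto
    qed (auto simp: E_def l_coset_def)
    moreover have "\<mu> (g <#\<^bsub>G\<^esub> E g) = \<mu> (E g)"
      using assms(1) g by (auto simp: invariant_mean_def E_def)
    ultimately show ?thesis by simp
  qed
  \<comment> \<open>The family is indexed by the group elements themselves. Thus the elements
    \<open>b k\<close> are distinct even if some of the sets \<open>E g\<close> coincide.\<close>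
  then obtain b :: "nat \<Rightarrow> 'a" where b: "inj b" "range b \<subseteq> carrier G" "\<And>n. 0 < \<mu> (\<Inter>k\<le>n. E (b k))"
    using intersectivity[of "carrier G" E "\<mu> A"] assms by (auto simp: E_def)
  have sub: "(\<Inter>k\<le>n. E (b k)) \<subseteq> carrier G" for n by (auto simp: E_def)
  have "infinite (\<Inter>k\<le>n. E (b k))" for n
    using invariant_mean_finite[OF assms(1,2) sub] b(3) by (metis less_irrefl)
  \<comment> \<open>Taking \<open>c n\<close> from the intersection over all
    \<open>k \<le> n\<close>, with \<open>n\<close> included, gives membership in \<open>A\<close>
    on the diagonal too.\<close>
  then obtain c where c: "inj c" "\<And>n. c n \<in> (\<Inter>k\<le>n. E (b k))"
    using infinite_sets_distinct_representatives[of "\<lambda>n. \<Inter>k\<le>n. E (b k)"] by blast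
  have "range c \<subseteq> carrier G" using c(2) sub by blast
  moreover have "b i \<otimes> c j \<in> A" if "i \<le> j" for i j using c(2)[of j] that by (auto simp: E_def)
  ultimately show ?thesis using b c by blast
qed

theorem theorem2p6:
  fixes M :: "('a, 'f, 'r) fo_structure" and G :: "('a, 'b) monoid_scheme" and A :: "'a set"
  assumes "expands_group M G"
    and "amenable_group G"
    and "infinite (carrier G)"
    and "definable M A"
    and "stable_set G A"
    and "upper_banach_density G A > 0"
  shows "\<exists>B C. B \<subseteq> carrier G \<and> C \<subseteq> carrier G \<and> infinite B \<and> infinite C \<and> B <#>\<^bsub>G\<^esub> C \<subseteq> A"
proof -
  interpret group G using assms(1) by (simp add: expands_group_def)
  have "A \<subseteq> carrier G" using assms(1,4) by (auto simp: expands_group_def definable_def)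
  moreover obtain \<mu> where "invariant_mean G \<mu>" "0 < \<mu> A"
    using upper_banach_density_pos_invariant_mean assms(6) by blast
  ultimately obtain b c :: "nat \<Rightarrow> 'a" where "inj b" "inj c" "range b \<subseteq> carrier G" "range c \<subseteq> carrier G"
    "\<And>i j. i \<le> j \<Longrightarrow> b i \<otimes>\<^bsub>G\<^esub> c j \<in> A"
    using invariant_mean_half_graph assms(3) by blast
  then show ?thesis by (rule stable_set_product_subset[OF assms(5)])
qed

end
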